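(* Let $n\ge 2$ and let the domain of locations be $X=[0,1]$. A randomized facility location mechanism for $n$ agents on $X$ is universally anonymous, universally truthful and satisfies Strong Proportional Fairness (SPF) in expectation if and only if it is the Random Rank mechanism.
   Context: Let $N=\{1,\dots,n\}$ be a set of agents, $n\ge 2$, and $X=[0,1]$. A location profile is $x=(x_1,\dots,x_n)\in X^n$, and $d(a,b)=|a-b|$. A deterministic mechanism is a map $f:X^n\to X$. It is anonymous if $f(x_{\sigma(1)},\dots,x_{\sigma(n)})=f(x)$ for every $x\in X^n$ and every bijection $\sigma:N\to N$. It is strategyproof if for every agent $i\in N$, all $x_i,x_i'\in X$ and every profile $\hat x_{-i}$ of locations of the other agents, $d(x_i,f(x_i,\hat x_{-i}))\le d(x_i,f(x_i',\hat x_{-i}))$. A randomized mechanism is a probability distribution over deterministic mechanisms, i.e. a random deterministic mechanism $f$ (such that $f(x)$ is a random variable for each fixed $x\in X^n$). It is universally anonymous (respectively universally truthful) if it is a distribution over deterministic anonymous (respectively deterministic strategyproof) mechanisms, i.e. the realized mechanism is almost surely anonymous (respectively strategyproof). "It is the Random Rank mechanism" means equality as probability distributions over deterministic mechanisms. A randomized mechanism $f$ satisfies Strong Proportional Fairness (SPF) in expectation if for every location profile $x$ within range $R$ (i.e. $R=\max_{j\in N}x_j-\min_{j\in N}x_j$) and every nonempty subset $S\subseteq N$ of agents within range $r$ (i.e. $r=\max_{j\in S}x_j-\min_{j\in S}x_j$), $\mathbb{E}[d(x_i,f(x))]\le R\,\frac{n-|S|}{n}+r$ for all $i\in S$. For $k\in\{1,\dots,n\}$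 let $\operatorname{rank}^k(x)=\operatorname{med}(\underbrace{0,\dots,0}_{n-k},\underbrace{1,\dots,1}_{k-1},x_1,\dots,x_n)$, the median of these $2n-1$ numbers. The Random Rank mechanism chooses $k$ uniformly at random from $\{1,\dots,n\}$ and uses the deterministic mechanism $\operatorname{rank}^k$. *)

theory Defs
  imports "HOL-Probability.Probability"
begin

definition agents :: "nat \<Rightarrow> nat set" where
  "agents n = {1..n}"

definition profiles :: "nat \<Rightarrow> (nat \<Rightarrow> real) set" where
  "profiles n = agents n \<rightarrow>\<^sub>E {0..1}"

text \<open>Profiles and mechanisms are extensional functions, so that HOL equality of two of them is
  equality as maps on the agents and on the profiles, respectively.\<close>

definition mechanisms :: "nat \<Rightarrow> ((nat \<Rightarrow> real) \<Rightarrow> real) set" where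
  "mechanisms n = profiles n \<rightarrow>\<^sub>E {0..1}"

definition anonymous :: "nat \<Rightarrow> ((nat \<Rightarrow> real) \<Rightarrow> real) \<Rightarrow> bool" where
  "anonymous n f \<longleftrightarrow>
     (\<forall>x\<in>profiles n. \<forall>\<sigma>. bij_betw \<sigma> (agents n) (agents n) \<longrightarrow>
        f (\<lambda>i\<in>agents n. x (\<sigma> i)) = f x)"

definition strategyproof :: "nat \<Rightarrow> ((nat \<Rightarrow> real) \<Rightarrow> real) \<Rightarrow> bool" where
  "strategyproof n f \<longleftrightarrow>
     (\<forall>x\<in>profiles n. \<forall>i\<in>agents n. \<forall>x'\<in>{0..1}.
        dist (x i) (f x) \<le> dist (x i) (f (x(i := x'))))"

text \<open>A randomized mechanism is a probability measure on the set of deterministic mechanisms.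
  The \<open>\<sigma>\<close>-algebra is not fixed. It has to make every \<open>f x\<close> a random variable and
  to contain the two events that the universal properties refer to. The product \<open>\<sigma>\<close>-algebra
  does not suffice: its members depend on countably many profiles only, so no nonempty member
  consists of strategyproof (or of anonymous) mechanisms alone.\<close>

definition randomized_mechanism :: "nat \<Rightarrow> ((nat \<Rightarrow> real) \<Rightarrow> real) measure \<Rightarrow> bool" where
  "randomized_mechanism n M \<longleftrightarrow>
     prob_space M \<and> space M = mechanisms n \<and>
     (\<forall>x\<in>profiles n. (\<lambda>f. f x) \<in> borel_measurable M) \<and>
     {f \<in> space M. anonymous n f} \<in> sets M \<and>
     {f \<in> space M. strategyproof n f} \<in> sets M"

definition universally_anonymous :: "nat \<Rightarrow> ((nat \<Rightarrow> real) \<Rightarrow> real) measure \<Rightarrow> bool" where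
  "universally_anonymous n M \<longleftrightarrow> (AE f in M. anonymous n f)"

definition universally_truthful :: "nat \<Rightarrow> ((nat \<Rightarrow> real) \<Rightarrow> real) measure \<Rightarrow> bool" where
  "universally_truthful n M \<longleftrightarrow> (AE f in M. strategyproof n f)"

definition spread :: "(nat \<Rightarrow> real) \<Rightarrow> nat set \<Rightarrow> real" where
  "spread x S = Max (x ` S) - Min (x ` S)"

definition SPF_in_expectation :: "nat \<Rightarrow> ((nat \<Rightarrow> real) \<Rightarrow> real) measure \<Rightarrow> bool" where
  "SPF_in_expectation n M \<longleftrightarrow>
     (\<forall>x\<in>profiles n. \<forall>S. S \<subseteq> agents n \<longrightarrow> S \<noteq> {} \<longrightarrow> (\<forall>i\<in>S.
        (\<integral>f. dist (x i) (f x) \<partial>M)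
          \<le> spread x (agents n) * ((real n - real (card S)) / real n) + spread x S))"

text \<open>The median of a list of odd length.\<close>

definition median :: "real list \<Rightarrow> real" where
  "median xs = sort xs ! (length xs div 2)"

definition rank_mechanism :: "nat \<Rightarrow> nat \<Rightarrow> (nat \<Rightarrow> real) \<Rightarrow> real" where
  "rank_mechanism n k =
     (\<lambda>x\<in>profiles n. median (replicate (n - k) 0 @ replicate (k - 1) 1 @ map x [1..<Suc n]))"

text \<open>The law of \<open>rank_mechanism n k\<close> for uniformly distributed \<open>k\<close>. The argument \<open>A\<close>
  only supplies the space and the \<open>\<sigma>\<close>-algebra on which this law is considered; the values
  of the measure \<open>A\<close> are irrelevant.\<close>

definition random_rank ::
  "nat \<Rightarrow> ((nat \<Rightarrow> real) \<Rightarrow> real) measure \<Rightarrow> ((nat \<Rightarrow> real) \<Rightarrow> real) measure" where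
  "random_rank n A = distr (uniform_count_measure {1..n}) A (rank_mechanism n)"

end

theory Submission imports Defs begin

text \<open>Write \<open>\<alpha>\<^sub>j = f (0, \<dots>, 0, 1, \<dots>, 1)\<close> with \<open>j\<close> zeros. Strong Proportional Fairness forces
  unanimity almost surely. For an anonymous, strategyproof and unanimous \<open>f\<close>, the outcome on a profile
  with \<open>j\<close> agents at \<open>s\<close> and \<open>n - j\<close> agents at \<open>t \<ge> s\<close> is \<open>\<alpha>\<^sub>j\<close> clamped to \<open>[s, t]\<close>. On such
  profiles fairness determines the expected outcome; comparing \<open>[0, 1]\<close> with \<open>[0, 1/2]\<close> gives
  \<open>E (min (1/2) \<alpha>\<^sub>j) = E \<alpha>\<^sub>j / 2\<close>, so that \<open>\<alpha>\<^sub>j \<in> {0, 1}\<close> almost surely, with mean \<open>(n - j) / n\<close>.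
  As \<open>\<alpha>\<close> decreases from \<open>\<alpha>\<^sub>0 = 1\<close> to \<open>\<alpha>\<^sub>n = 0\<close>, exactly one \<open>k\<close> has \<open>\<alpha>\<^sub>k\<^sub>-\<^sub>1 - \<alpha>\<^sub>k = 1\<close>, and then
  \<open>f = rank\<^sup>k\<close>. So \<open>\<alpha>\<^sub>k\<^sub>-\<^sub>1 - \<alpha>\<^sub>k\<close> is almost surely the indicator of \<open>f = rank\<^sup>k\<close>, and its mean is \<open>1/n\<close>.\<close>

section \<open>Order statistics\<close>

lemma finite_agents [simp]: "finite (agents n)"
  by (simp add: agents_def)

lemma card_agents [simp]: "card (agents n) = n"
  by (simp add: agents_def)

lemma profilesD: "x \<in> profiles n \<Longrightarrow> i \<in> agents n \<Longrightarrow> 0 \<le> x i \<and> x i \<le> 1"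
  by (auto simp: profiles_def PiE_def Pi_def)

lemma mechanismsD: "f \<in> mechanisms n \<Longrightarrow> x \<in> profiles n \<Longrightarrow> 0 \<le> f x \<and> f x \<le> 1"
  by (auto simp: mechanisms_def PiE_def Pi_def)

lemma profiles_update:
  "x \<in> profiles n \<Longrightarrow> i \<in> agents n \<Longrightarrow> c \<in> {0..1} \<Longrightarrow> x(i := c) \<in> profiles n"
  unfolding profiles_def PiE_def extensional_def Pi_def by auto

lemma profiles_restrict:
  "(\<And>i. i \<in> agents n \<Longrightarrow> g i \<in> {0..1}) \<Longrightarrow> (\<lambda>i\<in>agents n. g i) \<in> profiles n"
  unfolding profiles_def by auto

text \<open>Counted over the indices of the sorted list, the entries below the one at
  \<open>m\<close> all sit before position \<open>m\<close>, and the entries at positions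
  \<open>0, ..., m\<close> do not exceed it.\<close>

lemma card_filter_sorted_nth:
  fixes xs :: "real list"
  assumes "m < length xs"
  shows "length (filter (\<lambda>z. z < sort xs ! m) xs) \<le> m"
    and "m < length (filter (\<lambda>z. z \<le> sort xs ! m) xs)"
proof -
  let ?s = "sort xs"
  have len: "length (filter P xs) = card {i. i < length xs \<and> P (?s ! i)}" for P
  proof -
    have "length (filter P xs) = length (filter P ?s)"
      by (metis mset_filter mset_sort size_mset)
    then show ?thesis
      by (simp add: length_filter_conv_card)
  qed
  have "{i. i < length xs \<and> ?s ! i < ?s ! m} \<subseteq> {..<m}"
    using assms by (auto simp: not_le[symmetric] sorted_nth_mono)
  from card_mono[OF _ this] show "length (filter (\<lambda>z. z < ?s ! m) xs) \<le> m"
    by (simp add: len)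
  have "{..m} \<subseteq> {i. i < length xs \<and> ?s ! i \<le> ?s ! m}"
    using assms by (auto intro: sorted_nth_mono)
  from card_mono[OF _ this] show "m < length (filter (\<lambda>z. z \<le> ?s ! m) xs)"
    by (simp add: len)
qed

lemma length_filter_map_agents:
  "length (filter P (map x [1..<Suc n])) = card {i \<in> agents n. P (x i)}"
proof -
  have "length (filter P (map x [1..<Suc n])) = length (filter (P \<circ> x) [1..<Suc n])"
    by (simp add: filter_map)
  also have "\<dots> = card (set (filter (P \<circ> x) [1..<Suc n]))"
    by (rule distinct_card[symmetric]) simp
  also have "set (filter (P \<circ> x) [1..<Suc n]) = {i \<in> agents n. P (x i)}"
    by (auto simp: agents_def)
  finally show ?thesis .
qed

text \<open>All locations lie in [0,1], so sorting puts the \<open>n - k\<close> zeros first and the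
  \<open>k - 1\<close> ones last. The median index \<open>n - 1\<close> then falls on position
  \<open>k - 1\<close> of the sorted locations: \<open>rank^k\<close> is the k-th smallest
  location.\<close>

lemma rank_mechanism_eq_nth:
  assumes "x \<in> profiles n" "k \<in> {1..n}"
  shows "rank_mechanism n k x = sort (map x [1..<Suc n]) ! (k - 1)"
proof -
  let ?xs = "map x [1..<Suc n]"
  have unit: "z \<in> {0..1}" if "z \<in> set ?xs" for z
    using that assms(1) by (auto simp: agents_def dest!: profilesD)
  have "sort (replicate (n - k) 0 @ replicate (k - 1) 1 @ ?xs)
      = replicate (n - k) 0 @ sort ?xs @ replicate (k - 1) 1"
    by (rule properties_for_sort) (use unit in \<open>auto simp: sorted_append simp del: upt_Suc\<close>)
  moreover have "(n - k + (k - 1 + n)) div 2 = n - 1"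
    using assms(2) by auto
  moreover have "n - 1 - (n - k) = k - 1" "n - k \<le> n - 1" "k - 1 < n"
    using assms(2) by auto
  ultimately show ?thesis
    using assms by (simp add: rank_mechanism_def median_def nth_append del: upt_Suc)
qed

text \<open>These two counts pin down the k-th smallest location (see
  \<open>rank_mechanism_eqI\<close>); anonymity and truthfulness are argued from them.\<close>

lemma rank_mechanism_counts:
  assumes "x \<in> profiles n" "k \<in> {1..n}"
  shows "card {i \<in> agents n. x i < rank_mechanism n k x} < k"
    and "k \<le> card {i \<in> agents n. x i \<le> rank_mechanism n k x}"
proof -
  have "k - 1 < length (map x [1..<Suc n])"
    using assms(2) by auto
  from card_filter_sorted_nth[OF this] assms(2)
  show "card {i \<in> agents n. x i < rank_mechanism n k x} < k"
    and "k \<le> card {i \<in> agents n. x i \<le> rank_mechanism n k x}"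
    unfolding rank_mechanism_eq_nth[OF assms] length_filter_map_agents by auto
qed

text \<open>Of two distinct candidates, the agents weakly left of the smaller are strictly left of
  the larger, which would put at least k agents into a set of fewer than k.\<close>

lemma rank_mechanism_eqI:
  assumes "x \<in> profiles n" "k \<in> {1..n}"
    and "card {i \<in> agents n. x i < y} < k" "k \<le> card {i \<in> agents n. x i \<le> y}"
  shows "rank_mechanism n k x = y"
proof (rule ccontr)
  assume "rank_mechanism n k x \<noteq> y"
  then consider "rank_mechanism n k x < y" | "y < rank_mechanism n k x"
    by linarith
  then show False
  proof cases
    case 1
    then have "{i \<in> agents n. x i \<le> rank_mechanism n k x} \<subseteq> {i \<in> agents n. x i < y}"
      by auto
    from card_mono[OF _ this] show False
      using rank_mechanism_counts(2)[OF assms(1,2)] assms(3) by simp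
  next
    case 2
    then have "{i \<in> agents n. x i \<le> y} \<subseteq> {i \<in> agents n. x i < rank_mechanism n k x}"
      by auto
    from card_mono[OF _ this] show False
      using rank_mechanism_counts(1)[OF assms(1,2)] assms(4) by simp
  qed
qed

section \<open>Range, anonymity, truthfulness and averages of the rank mechanisms\<close>

lemma rank_mechanism_in_mechanisms:
  assumes "k \<in> {1..n}"
  shows "rank_mechanism n k \<in> mechanisms n"
proof -
  have "rank_mechanism n k x \<in> {0..1}" if x: "x \<in> profiles n" for x
  proof -
    have "sort (map x [1..<Suc n]) ! (k - 1) \<in> set (sort (map x [1..<Suc n]))"
      using assms by (intro nth_mem) auto
    then show ?thesis
      unfolding rank_mechanism_eq_nth[OF x assms]
      using x by (auto simp: agents_def dest!: profilesD)
  qed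
  then show ?thesis
    by (auto simp: mechanisms_def rank_mechanism_def)
qed

lemma anonymous_rank_mechanism:
  assumes "k \<in> {1..n}"
  shows "anonymous n (rank_mechanism n k)"
  unfolding anonymous_def
proof (intro ballI allI impI)
  fix x \<sigma>
  assume x: "x \<in> profiles n" and \<sigma>: "bij_betw \<sigma> (agents n) (agents n)"
  let ?y = "\<lambda>i\<in>agents n. x (\<sigma> i)"
  have y: "?y \<in> profiles n"
    by (rule profiles_restrict) (use x \<sigma> in \<open>auto dest: profilesD bij_betwE\<close>)
  have card: "card {i \<in> agents n. P (?y i)} = card {i \<in> agents n. P (x i)}" for P
  proof (rule bij_betw_same_card)
    show "bij_betw \<sigma> {i \<in> agents n. P (?y i)} {i \<in> agents n. P (x i)}"
      using \<sigma> by (fastforce simp: bij_betw_def inj_on_def)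
  qed
  show "rank_mechanism n k ?y = rank_mechanism n k x"
    using rank_mechanism_counts[OF x assms] card[of "\<lambda>z. z < rank_mechanism n k x"]
      card[of "\<lambda>z. z \<le> rank_mechanism n k x"]
    by (intro rank_mechanism_eqI[OF y assms]) presburger+
qed

text \<open>On whichever side of the outcome an agent is, a misreport can only leave the outcome in
  place or push it further away.\<close>

lemma strategyproof_rank_mechanism:
  assumes k: "k \<in> {1..n}"
  shows "strategyproof n (rank_mechanism n k)"
  unfolding strategyproof_def
proof (intro ballI)
  fix x i and c :: real
  assume x: "x \<in> profiles n" and i: "i \<in> agents n" and c: "c \<in> {0..1}"
  let ?x' = "x(i := c)"
  let ?y = "rank_mechanism n k x" and ?y' = "rank_mechanism n k ?x'"
  have x': "?x' \<in> profiles n"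
    using x i c by (rule profiles_update)
  have ge: "?y \<le> ?y'" if "x i < ?y"
  proof (rule ccontr)
    assume "\<not> ?y \<le> ?y'"
    \<comment> \<open>Agent \<open>i\<close> is in the right-hand set because
      \<open>x i < ?y\<close>, whatever the report \<open>c\<close>; any other \<open>j\<close> on
      the left has \<open>x j \<le> ?y'\<close>, and \<open>?y' < ?y\<close>.\<close>
    then have "{j \<in> agents n. ?x' j \<le> ?y'} \<subseteq> {j \<in> agents n. x j < ?y}"
      using that by auto
    from card_mono[OF _ this] show False
      using rank_mechanism_counts(2)[OF x' k] rank_mechanism_counts(1)[OF x k] by simp
  qed
  have le: "?y' \<le> ?y" if "?y < x i"
  proof (rule ccontr)
    assume "\<not> ?y' \<le> ?y"
    then have "{j \<in> agents n. x j \<le> ?y} \<subseteq> {j \<in> agents n. ?x' j < ?y'}"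
      using that by auto
    from card_mono[OF _ this] show False
      using rank_mechanism_counts(1)[OF x' k] rank_mechanism_counts(2)[OF x k] by simp
  qed
  show "dist (x i) ?y \<le> dist (x i) ?y'"
    using ge le unfolding dist_real_def by linarith
qed

text \<open>As k runs through \<open>1, ..., n\<close>, the outcomes run through the sorted
  locations. An expectation under Random Rank is thus an average over the agents.\<close>

lemma sum_rank_mechanism:
  fixes g :: "real \<Rightarrow> real"
  assumes x: "x \<in> profiles n"
  shows "(\<Sum>k\<in>{1..n}. g (rank_mechanism n k x)) = (\<Sum>i\<in>agents n. g (x i))"
proof -
  let ?xs = "map x [1..<Suc n]"
  have "(\<Sum>k\<in>{1..n}. g (rank_mechanism n k x)) = (\<Sum>k\<in>{1..n}. g (sort ?xs ! (k - 1)))"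
    by (intro sum.cong refl) (use rank_mechanism_eq_nth[OF x] in auto)
  also have "\<dots> = (\<Sum>k<n. g (sort ?xs ! k))"
    by (rule sum.reindex_bij_witness[of _ Suc "\<lambda>k. k - 1"]) auto
  also have "\<dots> = sum_list (map g (sort ?xs))"
    by (simp add: sum_list_sum_nth atLeast0LessThan del: upt_Suc)
  also have "\<dots> = sum_list (map g ?xs)"
    by (metis mset_map mset_sort sum_mset_sum_list)
  also have "\<dots> = sum_list (map (\<lambda>i. g (x i)) [1..<Suc n])"
    by (simp add: comp_def)
  also have "\<dots> = (\<Sum>i\<in>agents n. g (x i))"
    by (subst sum_list_distinct_conv_sum_set)
      (auto simp: agents_def atLeastLessThanSuc_atLeastAtMost simp del: upt_Suc)
  finally show ?thesis .
qed

section \<open>Strategyproof mechanisms\<close>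

lemma strategyproofD:
  assumes "strategyproof n f" "x \<in> profiles n" "i \<in> agents n" "c \<in> {0..1}"
  shows "\<bar>x i - f x\<bar> \<le> \<bar>x i - f (x(i := c))\<bar>"
  using assms unfolding strategyproof_def dist_real_def by blast

text \<open>The agents of \<open>S\<close> move one at a time. Each is still at \<open>c\<close>
  when its turn comes, so by truthfulness no step brings the outcome closer to
  \<open>c\<close>.\<close>

lemma strategyproof_group:
  assumes sp: "strategyproof n f" and "S \<subseteq> agents n"
    and "x \<in> profiles n" "x' \<in> profiles n"
    and "\<And>i. i \<in> S \<Longrightarrow> x i = c" "\<And>i. i \<notin> S \<Longrightarrow> x' i = x i"
  shows "\<bar>c - f x\<bar> \<le> \<bar>c - f x'\<bar>"
proof -
  have "finite S"
    using assms(2) finite_agents finite_subset by blast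
  then show ?thesis
    using assms(2-)
  proof (induction S arbitrary: x rule: finite_induct)
    case empty
    then have "x' = x" by auto
    then show ?case by simp
  next
    case (insert i S)
    have i: "i \<in> agents n" and c': "x' i \<in> {0..1}"
      using insert.prems(1,3) by (auto dest: profilesD)
    have "\<bar>c - f x\<bar> \<le> \<bar>c - f (x(i := x' i))\<bar>"
      using strategyproofD[OF sp insert.prems(2) i c'] insert.prems(4)[of i] by simp
    also have "\<dots> \<le> \<bar>c - f x'\<bar>"
    proof (rule insert.IH)
      show "x(i := x' i) \<in> profiles n"
        using insert.prems(2) i c' by (rule profiles_update)
    qed (use insert in auto)
    finally show ?case .
  qed
qed

text \<open>Let one agent move from a to b between a and the outcome y. Truthfulness at b keeps the
  new outcome within |b - y| of b, truthfulness at a keeps it at least |a - y| away from a; for a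
  different from b only y satisfies both. The agents are moved in turn.\<close>

lemma strategyproof_move_towards_outcome:
  assumes sp: "strategyproof n f"
    and "x \<in> profiles n" "x' \<in> profiles n"
    and "\<And>i. i \<in> agents n \<Longrightarrow> x' i \<in> closed_segment (x i) (f x)"
  shows "f x' = f x"
proof -
  have "f x' = f x" if "S \<subseteq> agents n" "x \<in> profiles n"
    "\<And>i. i \<in> agents n \<Longrightarrow> x' i \<in> closed_segment (x i) (f x)"
    "\<And>i. i \<notin> S \<Longrightarrow> x' i = x i" for S x
  proof -
    have "finite S"
      using that(1) finite_agents finite_subset by blast
    then show ?thesis
      using that
    proof (induction S arbitrary: x rule: finite_induct)
      case empty
      then have "x' = x" by auto
      then show ?case by simp
    next
      case (insert i S)
      have i: "i \<in> agents n" and c': "x' i \<in> {0..1}"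
        using insert.prems(1) assms(3) by (auto dest: profilesD)
      let ?z = "x(i := x' i)"
      have z: "?z \<in> profiles n"
        using insert.prems(2) i c' by (rule profiles_update)
      have "x i \<in> {0..1}"
        using insert.prems(2) i by (auto dest: profilesD)
      from strategyproofD[OF sp z i this]
      have 1: "\<bar>x' i - f ?z\<bar> \<le> \<bar>x' i - f x\<bar>"
        by simp
      have 2: "\<bar>x i - f x\<bar> \<le> \<bar>x i - f ?z\<bar>"
        by (rule strategyproofD[OF sp insert.prems(2) i c'])
      have eq: "f ?z = f x"
      \<comment> \<open>If the agent stays, the two inequalities would also admit the mirror image
        of \<open>f x\<close>, but then the profile is unchanged.\<close>
      proof (cases "x' i = x i")
        case True
        then have "?z = x" by auto
        then show ?thesis by simp
      next
        case False
        then show ?thesis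
          using 1 2 insert.prems(3)[OF i] unfolding closed_segment_eq_real_ivl
          by (auto split: if_splits)
      qed
      have "f x' = f ?z"
      proof (rule insert.IH[OF _ z])
        fix l
        assume "l \<in> agents n"
        then show "x' l \<in> closed_segment (?z l) (f ?z)"
          using insert.prems(3) unfolding eq by (cases "l = i") auto
      qed (use insert.prems in auto)
      then show ?case using eq by simp
    qed
  qed
  \<comment> \<open>Outside \<open>agents n\<close> both profiles are \<open>undefined\<close>, so
    they agree there.\<close>
  from this[of "agents n" x] show ?thesis
    using assms by (metis PiE_arb order_refl profiles_def)
qed

section \<open>Truthful choice by one and by two agents\<close>

text \<open>Here \<open>g t\<close> is a point of the range of \<open>g\<close> nearest to
  \<open>t\<close>, and never above \<open>t\<close>. A gap in the range below \<open>g b\<close> is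
  impossible: a peak just below the upper end of the gap would have to choose a value beyond the
  lower end, although the upper end is nearer.\<close>

lemma nearest_point_below_eq_min:
  fixes g :: "real \<Rightarrow> real"
  assumes near: "\<And>t u. t \<in> {a..b} \<Longrightarrow> u \<in> {a..b} \<Longrightarrow> \<bar>t - g t\<bar> \<le> \<bar>t - g u\<bar>"
    and bnd: "\<And>t. t \<in> {a..b} \<Longrightarrow> g t \<in> {a..t}"
    and t: "t \<in> {a..b}"
  shows "g t = min t (g b)"
proof (cases "g b \<le> t")
  case True
  have "b \<in> {a..b}" using t by auto
  with True show ?thesis
    using near[OF t \<open>b \<in> _\<close>] near[OF \<open>b \<in> _\<close> t] bnd[OF t] bnd[OF \<open>b \<in> _\<close>] t by auto
next
  case False
  have "g t = t"
  proof (rule ccontr)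
    assume "g t \<noteq> t"
    define c where "c = g t"
    have c: "a \<le> c" "c < t"
      using bnd[OF t] \<open>g t \<noteq> t\<close> by (auto simp: c_def)
    define V where "V = {v \<in> g ` {a..b}. t < v}"
    define m where "m = Inf V"
    have gb: "g b \<in> V" and b: "b \<in> {a..b}"
      using False t by (auto simp: V_def)
    \<comment> \<open>\<open>2 * t - c\<close> is the mirror image of \<open>c\<close> at
      \<open>t\<close>: a value above \<open>t\<close> but closer would be preferred to
      \<open>c\<close>.\<close>
    have V_ge: "2 * t - c \<le> v" if "v \<in> V" for v
      using that near[OF t] c by (force simp: V_def c_def)
    then have bdd: "bdd_below V"
      by (rule bdd_belowI)
    have m_gt: "2 * t - c \<le> m"
      unfolding m_def using gb V_ge by (intro cInf_greatest) auto
    have m_le: "m \<le> b"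
      using cInf_lower[OF gb bdd] bnd[OF b] by (auto simp: m_def)
    have "Inf V < m + (m - c) / 4"
      using m_gt c by (simp add: m_def[symmetric])
    then obtain v where v: "v \<in> V" "v < m + (m - c) / 4"
      using gb cInf_lessD by blast
    \<comment> \<open>With a quarter of the gap length \<open>m - c\<close> on either side of
      \<open>m\<close>, the value \<open>v\<close> is less than half of it away from this peak,
      while every value up to \<open>c\<close> is at least three quarters away.\<close>
    define \<tau> where "\<tau> = m - (m - c) / 4"
    have \<tau>: "\<tau> \<in> {a..b}" "\<tau> < m"
      using m_gt m_le c by (auto simp: \<tau>_def field_simps)
    from bnd[OF \<tau>(1)] \<tau>(2) have "g \<tau> \<notin> V"
      using cInf_lower[OF _ bdd] by (fastforce simp: m_def)
    then have "g \<tau> \<le> t"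
      using \<tau>(1) by (auto simp: V_def)
    then have "g \<tau> \<le> c"
      using near[OF t \<tau>(1)] c by (simp add: c_def)
    moreover have "\<bar>\<tau> - g \<tau>\<bar> \<le> \<bar>\<tau> - v\<bar>"
      using v(1) near[OF \<tau>(1)] by (auto simp: V_def)
    moreover have "m \<le> v"
      using cInf_lower[OF v(1) bdd] by (simp add: m_def)
    ultimately show False
      using v(2) c m_gt \<tau>(2) unfolding \<tau>_def by (simp add: abs_if field_simps split: if_splits)
  qed
  with False show ?thesis by simp
qed

text \<open>The preceding lemma is used twice: for the right agent with \<open>s\<close> fixed,
  reducing \<open>t\<close> to 1, and then for the left agent with \<open>t = 1\<close>, reducing
  \<open>s\<close> to 0.\<close>

lemma two_agent_clamp:
  fixes F :: "real \<Rightarrow> real \<Rightarrow> real"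
  assumes sp1: "\<And>s s' t. s \<in> {0..1} \<Longrightarrow> s' \<in> {0..1} \<Longrightarrow> t \<in> {0..1} \<Longrightarrow> \<bar>s - F s t\<bar> \<le> \<bar>s - F s' t\<bar>"
    and sp2: "\<And>s t t'. s \<in> {0..1} \<Longrightarrow> t \<in> {0..1} \<Longrightarrow> t' \<in> {0..1} \<Longrightarrow> \<bar>t - F s t\<bar> \<le> \<bar>t - F s t'\<bar>"
    and unan: "\<And>t. t \<in> {0..1} \<Longrightarrow> F t t = t"
    and st: "0 \<le> s" "s \<le> t" "t \<le> 1"
  shows "F s t = max s (min t (F 0 1))"
proof -
  \<comment> \<open>Either agent could report the other's location and obtain it by unanimity, so
    the outcome is within \<open>t - s\<close> of both.\<close>
  have bnd: "F s t \<in> {s..t}" if "0 \<le> s" "s \<le> t" "t \<le> 1" for s t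
    using sp1[of s t t] sp2[of s t s] unan[of s] unan[of t] that by (auto simp: abs_if split: if_splits)
  have "F s t = min t (F s 1)"
  proof (rule nearest_point_below_eq_min[of s 1 "F s"])
    show "\<bar>t - F s t\<bar> \<le> \<bar>t - F s u\<bar>" if "t \<in> {s..1}" "u \<in> {s..1}" for t u
      using sp2[of s t u] st that by simp
  qed (use bnd st in auto)
  \<comment> \<open>The reflection of [0,1] turns a left agent whose outcome lies above it into the
    situation of the preceding lemma.\<close>
  moreover have "1 - F (1 - (1 - s)) 1 = min (1 - s) (1 - F (1 - 1) 1)"
  proof (rule nearest_point_below_eq_min[of 0 1 "\<lambda>u. 1 - F (1 - u) 1"])
    fix t u :: real
    assume "t \<in> {0..1}" "u \<in> {0..1}"
    then show "\<bar>t - (1 - F (1 - t) 1)\<bar> \<le> \<bar>t - (1 - F (1 - u) 1)\<bar>"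
      using sp1[of "1 - t" "1 - u" 1] by (simp add: abs_if split: if_splits)
  next
    fix t :: real
    assume "t \<in> {0..1}"
    then show "1 - F (1 - t) 1 \<in> {0..t}"
      using bnd[of "1 - t" 1] by simp
  qed (use st in auto)
  ultimately show ?thesis
    using st by (auto simp: min_def max_def split: if_splits)
qed

section \<open>Two-block profiles and phantom voters\<close>

definition block_profile :: "nat \<Rightarrow> nat set \<Rightarrow> real \<Rightarrow> real \<Rightarrow> nat \<Rightarrow> real" where
  "block_profile n L s t = (\<lambda>i\<in>agents n. if i \<in> L then s else t)"

definition unanimous :: "nat \<Rightarrow> ((nat \<Rightarrow> real) \<Rightarrow> real) \<Rightarrow> bool" where
  "unanimous n f \<longleftrightarrow> (\<forall>c\<in>{0..1}. f (\<lambda>i\<in>agents n. c) = c)"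

text \<open>The \<open>\<alpha>\<^sub>j\<close> of the introduction, a phantom voter in Moulin's sense.\<close>

definition phantom :: "nat \<Rightarrow> ((nat \<Rightarrow> real) \<Rightarrow> real) \<Rightarrow> nat \<Rightarrow> real" where
  "phantom n f j = f (block_profile n {1..j} 0 1)"

lemma block_profile_in_profiles:
  "s \<in> {0..1} \<Longrightarrow> t \<in> {0..1} \<Longrightarrow> block_profile n L s t \<in> profiles n"
  unfolding block_profile_def by (rule profiles_restrict) auto

text \<open>A bijection from \<open>L\<close> onto \<open>{1..card L}\<close> and one between the
  complements glue to a permutation of the agents.\<close>

lemma anonymous_block_profile:
  assumes "anonymous n f" "s \<in> {0..1}" "t \<in> {0..1}" "L \<subseteq> agents n"
  shows "f (block_profile n L s t) = f (block_profile n {1..card L} s t)"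
proof -
  let ?J = "{1..card L}"
  have J: "?J \<subseteq> agents n"
    using card_mono[OF finite_agents assms(4)] by (auto simp: agents_def)
  have finL: "finite L"
    using assms(4) finite_agents finite_subset by blast
  have "card (agents n - L) = card (agents n - ?J)"
    using J assms(4) finL by (simp add: card_Diff_subset)
  then obtain h where h: "bij_betw h (agents n - L) (agents n - ?J)"
    using finite_same_card_bij[of "agents n - L" "agents n - ?J"] by auto
  obtain g where g: "bij_betw g L ?J"
    using finite_same_card_bij[OF finL, of ?J] by auto
  let ?\<sigma> = "\<lambda>i. if i \<in> L then g i else h i"
  have "bij_betw ?\<sigma> (L \<union> (agents n - L)) (?J \<union> (agents n - ?J))"
    by (rule bij_betw_disjoint_Un[OF g h]) auto
  moreover have "L \<union> (agents n - L) = agents n" "?J \<union> (agents n - ?J) = agents n"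
    using assms(4) J by blast+
  ultimately have \<sigma>: "bij_betw ?\<sigma> (agents n) (agents n)"
    by simp
  have "(\<lambda>i\<in>agents n. block_profile n ?J s t (?\<sigma> i)) = block_profile n L s t"
    using bij_betwE[OF g] bij_betwE[OF h] J by (fastforce simp: block_profile_def restrict_def)
  then show ?thesis
    using assms(1) \<sigma> block_profile_in_profiles[OF assms(2,3), of n ?J]
    unfolding anonymous_def by metis
qed

text \<open>By \<open>strategyproof_group\<close> each block acts like a single truthful agent, so
  the two-agent result applies.\<close>

lemma block_outcome_eq_clamp:
  assumes sp: "strategyproof n f" and unan: "unanimous n f"
    and st: "0 \<le> s" "s \<le> t" "t \<le> 1" and j: "j \<le> n"
  shows "f (block_profile n {1..j} s t) = max s (min t (phantom n f j))"
  unfolding phantom_def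
proof (rule two_agent_clamp[of "\<lambda>s t. f (block_profile n {1..j} s t)"])
  fix s s' t :: real
  assume "s \<in> {0..1}" "s' \<in> {0..1}" "t \<in> {0..1}"
  then show "\<bar>s - f (block_profile n {1..j} s t)\<bar> \<le> \<bar>s - f (block_profile n {1..j} s' t)\<bar>"
    using j by (intro strategyproof_group[OF sp, of "{1..j}"] block_profile_in_profiles)
      (auto simp: block_profile_def agents_def)
next
  fix s t t' :: real
  assume "s \<in> {0..1}" "t \<in> {0..1}" "t' \<in> {0..1}"
  then show "\<bar>t - f (block_profile n {1..j} s t)\<bar> \<le> \<bar>t - f (block_profile n {1..j} s t')\<bar>"
    using j by (intro strategyproof_group[OF sp, of "agents n - {1..j}"] block_profile_in_profiles)
      (auto simp: block_profile_def agents_def)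
next
  fix t :: real
  assume "t \<in> {0..1}"
  then show "f (block_profile n {1..j} t t) = t"
    using unan by (simp add: unanimous_def block_profile_def)
qed (use st in auto)

lemma anonymous_block_outcome_eq_clamp:
  assumes an: "anonymous n f" and sp: "strategyproof n f" and unan: "unanimous n f"
    and st: "0 \<le> s" "s \<le> t" "t \<le> 1" and L: "L \<subseteq> agents n"
  shows "f (block_profile n L s t) = max s (min t (phantom n f (card L)))"
proof -
  have "f (block_profile n L s t) = f (block_profile n {1..card L} s t)"
    by (rule anonymous_block_profile[OF an _ _ L]) (use st in auto)
  also have "\<dots> = max s (min t (phantom n f (card L)))"
    using block_outcome_eq_clamp[OF sp unan st] card_mono[OF finite_agents L] by simp
  finally show ?thesis .
qed

lemma phantom_0: "unanimous n f \<Longrightarrow> phantom n f 0 = 1"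
  by (simp add: unanimous_def phantom_def block_profile_def)

lemma phantom_n: "unanimous n f \<Longrightarrow> phantom n f n = 0"
proof -
  assume "unanimous n f"
  moreover have "block_profile n {1..n} 0 1 = (\<lambda>i\<in>agents n. 0)"
    by (auto simp: block_profile_def agents_def)
  ultimately show ?thesis
    by (simp add: unanimous_def phantom_def)
qed

text \<open>The agents in \<open>{i<..j}\<close>, jointly located at 1, cannot gain by jointly
  moving to 0.\<close>

lemma phantom_antimono:
  assumes sp: "strategyproof n f" and f: "f \<in> mechanisms n" and "i \<le> j" "j \<le> n"
  shows "phantom n f j \<le> phantom n f i"
proof -
  have "\<bar>1 - phantom n f i\<bar> \<le> \<bar>1 - phantom n f j\<bar>"
    unfolding phantom_def using assms(3,4)
    by (intro strategyproof_group[OF sp, of "{i<..j}"] block_profile_in_profiles)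
      (auto simp: block_profile_def agents_def)
  moreover have "phantom n f i \<le> 1" "phantom n f j \<le> 1"
    unfolding phantom_def using mechanismsD[OF f block_profile_in_profiles] by simp_all
  ultimately show ?thesis by simp
qed

text \<open>The outcome has the two counts of the k-th smallest location. If one failed, the agents
  could be gathered into two blocks without changing the outcome, where the phantom 0 or 1 would put
  it at the block away from \<open>y\<close>.\<close>

lemma eq_rank_mechanism:
  assumes f: "f \<in> mechanisms n"
    and an: "anonymous n f" and sp: "strategyproof n f" and unan: "unanimous n f"
    and k: "k \<in> {1..n}" and ph: "phantom n f (k - 1) = 1" "phantom n f k = 0"
  shows "f = rank_mechanism n k"
proof
  fix x
  have ph1: "phantom n f j = 1" if "j < k" for j
  proof (rule antisym)
    show "phantom n f j \<le> 1"
      unfolding phantom_def using mechanismsD[OF f block_profile_in_profiles] by simp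
    show "1 \<le> phantom n f j"
      using phantom_antimono[OF sp f, of j "k - 1"] ph(1) k that by simp
  qed
  have ph0: "phantom n f j = 0" if "k \<le> j" "j \<le> n" for j
  proof (rule antisym)
    show "0 \<le> phantom n f j"
      unfolding phantom_def using mechanismsD[OF f block_profile_in_profiles] by simp
    show "phantom n f j \<le> 0"
      using phantom_antimono[OF sp f, of k j] ph(2) that by simp
  qed
  show "f x = rank_mechanism n k x"
  proof (cases "x \<in> profiles n")
    case False
    then show ?thesis
      using PiE_arb[OF f[unfolded mechanisms_def] False] by (simp add: rank_mechanism_def)
  next
    case x: True
    define y where "y = f x"
    have y: "0 \<le> y" "y \<le> 1"
      using mechanismsD[OF f x] by (auto simp: y_def)
    let ?L = "{i \<in> agents n. x i < y}" and ?L' = "{i \<in> agents n. x i \<le> y}"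
    have "card ?L < k"
    proof (rule ccontr)
      assume nk: "\<not> card ?L < k"
      moreover have "1 \<le> k"
        using k by simp
      ultimately have "card ?L \<noteq> 0"
        by linarith
      then have ne: "?L \<noteq> {}"
        by (metis card.empty)
      \<comment> \<open>The rightmost location left of \<open>y\<close>: everyone left of
        \<open>y\<close> can move up to \<open>w\<close>, everyone else to \<open>y\<close>, all
        towards the outcome.\<close>
      define w where "w = Max (x ` ?L)"
      have "w \<in> x ` ?L"
        unfolding w_def by (rule Max_in) (use ne in auto)
      then have w: "0 \<le> w" "w < y"
        using x by (auto dest: profilesD)
      have le_w: "x i \<le> w" if "i \<in> ?L" for i
        unfolding w_def by (rule Max_ge) (use that in auto)
      have "f (block_profile n ?L w y) = f x"
      proof (rule strategyproof_move_towards_outcome[OF sp x])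
        show "block_profile n ?L w y \<in> profiles n"
          using w y by (intro block_profile_in_profiles) auto
        show "block_profile n ?L w y i \<in> closed_segment (x i) (f x)" if "i \<in> agents n" for i
          unfolding y_def[symmetric] using that w(2) le_w[of i]
          by (auto simp: block_profile_def closed_segment_eq_real_ivl)
      qed
      moreover have "f (block_profile n ?L w y) = max w (min y (phantom n f (card ?L)))"
        by (rule anonymous_block_outcome_eq_clamp[OF an sp unan]) (use w y in auto)
      moreover have "phantom n f (card ?L) = 0"
        using nk card_mono[of "agents n" ?L] by (intro ph0) auto
      ultimately show False
        using w by (simp add: y_def)
    qed
    moreover have "k \<le> card ?L'"
    proof (rule ccontr)
      assume nk: "\<not> k \<le> card ?L'"
      moreover have "k \<le> n"
        using k by simp
      ultimately have "card ?L' \<noteq> n"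
        by linarith
      then have "?L' \<noteq> agents n"
        by (metis card_agents)
      then have ne: "agents n - ?L' \<noteq> {}"
        by blast
      define w where "w = Min (x ` (agents n - ?L'))"
      have "w \<in> x ` (agents n - ?L')"
        unfolding w_def by (rule Min_in) (use ne in auto)
      then have w: "w \<le> 1" "y < w"
        using x by (auto dest: profilesD)
      have w_le: "w \<le> x i" if "i \<in> agents n" "i \<notin> ?L'" for i
        unfolding w_def by (rule Min_le) (use that in auto)
      have "f (block_profile n ?L' y w) = f x"
      proof (rule strategyproof_move_towards_outcome[OF sp x])
        show "block_profile n ?L' y w \<in> profiles n"
          using w y by (intro block_profile_in_profiles) auto
        show "block_profile n ?L' y w i \<in> closed_segment (x i) (f x)" if "i \<in> agents n" for i
          unfolding y_def[symmetric] using that w(2) w_le[of i]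
          by (auto simp: block_profile_def closed_segment_eq_real_ivl)
      qed
      moreover have "f (block_profile n ?L' y w) = max y (min w (phantom n f (card ?L')))"
        by (rule anonymous_block_outcome_eq_clamp[OF an sp unan]) (use w y in auto)
      moreover have "phantom n f (card ?L') = 1"
        using nk by (intro ph1) auto
      ultimately show False
        using w by (simp add: y_def)
    qed
    ultimately show ?thesis
      using rank_mechanism_eqI[OF x k] by (simp add: y_def)
  qed
qed

text \<open>Agents all at \<open>c\<close> could jointly report a rational \<open>q\<close> near
  \<open>c\<close>, so the outcome is at most |c - q| away from \<open>c\<close>. Unanimity thus
  becomes a countable condition.\<close>

lemma unanimous_if_rational:
  assumes sp: "strategyproof n f"
    and rat: "\<And>q. q \<in> \<rat> \<Longrightarrow> q \<in> {0..1} \<Longrightarrow> f (\<lambda>i\<in>agents n. q) = q"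
  shows "unanimous n f"
  unfolding unanimous_def
proof
  fix c :: real
  assume c: "c \<in> {0..1}"
  have "\<bar>c - f (\<lambda>i\<in>agents n. c)\<bar> \<le> e" if "0 < e" for e
  proof -
    have "max 0 (c - e) < min 1 (c + e)"
      using c that by auto
    then obtain q where q: "q \<in> \<rat>" "max 0 (c - e) < q" "q < min 1 (c + e)"
      using Rats_dense_in_real by blast
    have "\<bar>c - f (\<lambda>i\<in>agents n. c)\<bar> \<le> \<bar>c - f (\<lambda>i\<in>agents n. q)\<bar>"
      by (rule strategyproof_group[OF sp, of "agents n"])
        (use c q in \<open>auto intro!: profiles_restrict\<close>)
    also have "f (\<lambda>i\<in>agents n. q) = q"
      using q by (intro rat) auto
    also have "\<bar>c - q\<bar> \<le> e"
      using q by auto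
    finally show ?thesis .
  qed
  then have "\<bar>c - f (\<lambda>i\<in>agents n. c)\<bar> \<le> 0"
    by (metis add_0 field_le_epsilon)
  then show "f (\<lambda>i\<in>agents n. c) = c"
    by simp
qed

section \<open>Randomized mechanisms\<close>

lemma randomized_mechanism_integrable:
  assumes "randomized_mechanism n M" "x \<in> profiles n"
  shows "integrable M (\<lambda>f. f x)"
proof -
  interpret prob_space M
    using assms(1) by (simp add: randomized_mechanism_def)
  show ?thesis
  proof (rule integrable_const_bound[of _ 1])
    show "AE f in M. norm (f x) \<le> 1"
      using assms mechanismsD by (intro AE_I2) (fastforce simp: randomized_mechanism_def)
    show "(\<lambda>f. f x) \<in> borel_measurable M"
      using assms by (simp add: randomized_mechanism_def)
  qed
qed

text \<open>On a constant profile with \<open>S = agents n\<close> both spreads vanish, so fairness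
  makes the expected distance zero.\<close>

lemma SPF_imp_AE_unanimous:
  assumes n: "n \<ge> 1" and M: "randomized_mechanism n M"
    and spf: "SPF_in_expectation n M" and sp: "universally_truthful n M"
  shows "AE f in M. unanimous n f"
proof -
  interpret prob_space M
    using M by (simp add: randomized_mechanism_def)
  have "AE f in M. f (\<lambda>i\<in>agents n. q) = q" if q: "q \<in> {0..1}" for q
  proof -
    let ?x = "\<lambda>i\<in>agents n. q"
    have x: "?x \<in> profiles n"
      using q by (intro profiles_restrict)
    have one: "1 \<in> agents n"
      using n by (simp add: agents_def)
    then have "?x ` agents n = {q}"
      by (auto simp: image_iff)
    then have "spread ?x (agents n) = 0"
      by (simp add: spread_def)
    with spf x one have "(\<integral>f. dist (?x 1) (f ?x) \<partial>M) \<le> 0"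
      unfolding SPF_in_expectation_def
      by (metis add.right_neutral empty_iff mult_zero_left order_refl)
    then have "(\<integral>f. \<bar>q - f ?x\<bar> \<partial>M) \<le> 0"
      using one by (simp add: dist_real_def)
    then have "(\<integral>f. \<bar>q - f ?x\<bar> \<partial>M) = 0"
      by (intro antisym integral_nonneg_AE) auto
    then have "AE f in M. \<bar>q - f ?x\<bar> = 0"
      using randomized_mechanism_integrable[OF M x]
      by (subst integral_nonneg_eq_0_iff_AE[symmetric]) auto
    then show ?thesis
      by eventually_elim auto
  qed
  \<comment> \<open>The exceptional null set depends on \<open>q\<close>; only countably many can be
    united.\<close>
  then have "AE f in M. \<forall>q\<in>\<rat> \<inter> {0..1}. f (\<lambda>i\<in>agents n. q) = q"
    by (subst AE_ball_countable) (auto simp: countable_rat)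
  with sp[unfolded universally_truthful_def] show ?thesis
    by eventually_elim (rule unanimous_if_rational, auto)
qed

text \<open>Fairness for the block at 0 bounds the mean from above, fairness for the block at
  \<open>t\<close> from below. The two bounds on the distances add up to \<open>t\<close>, so they
  leave a single value. Agents 1 and \<open>n\<close> represent the blocks.\<close>

lemma SPF_expectation_block:
  assumes M: "randomized_mechanism n M" and spf: "SPF_in_expectation n M"
    and j: "1 \<le> j" "j < n" and t: "0 \<le> t" "t \<le> 1"
  shows "(\<integral>f. f (block_profile n {1..j} 0 t) \<partial>M) = t * (real n - real j) / real n"
proof -
  interpret prob_space M
    using M by (simp add: randomized_mechanism_def)
  let ?x = "block_profile n {1..j} 0 t"
  have x: "?x \<in> profiles n"
    using t by (intro block_profile_in_profiles) auto
  have int: "integrable M (\<lambda>f. f ?x)"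
    by (rule randomized_mechanism_integrable[OF M x])
  have val: "?x i = 0" if "i \<in> {1..j}" for i
    using that j by (simp add: block_profile_def agents_def)
  have val': "?x i = t" if "i \<in> {j<..n}" for i
    using that j by (simp add: block_profile_def agents_def)
  have "agents n = {1..j} \<union> {j<..n}"
    using j by (auto simp: agents_def)
  moreover have im: "?x ` {1..j} = {0}" "?x ` {j<..n} = {t}"
    using val val' j by (force simp: image_iff)+
  ultimately have "?x ` agents n = {0, t}"
    by (simp add: image_Un insert_commute)
  then have R: "spread ?x (agents n) = t"
    using t by (simp add: spread_def)
  have r: "spread ?x {1..j} = 0" "spread ?x {j<..n} = 0"
    using im by (simp_all add: spread_def)
  have sub: "{1..j} \<subseteq> agents n" "{j<..n} \<subseteq> agents n"
    using j by (auto simp: agents_def)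
  have "(\<integral>f. dist (?x 1) (f ?x) \<partial>M) \<le> t * ((real n - real j) / real n)"
    using spf[unfolded SPF_in_expectation_def, rule_format, OF x sub(1), of 1] R r j by simp
  then have 1: "(\<integral>f. \<bar>f ?x\<bar> \<partial>M) \<le> t * ((real n - real j) / real n)"
    using val[of 1] j by (simp add: dist_real_def)
  have "(\<integral>f. dist (?x n) (f ?x) \<partial>M) \<le> t * ((real n - real (n - j)) / real n)"
    using spf[unfolded SPF_in_expectation_def, rule_format, OF x sub(2), of n] R r j by simp
  then have 2: "(\<integral>f. \<bar>t - f ?x\<bar> \<partial>M) \<le> t * (real j / real n)"
    using val'[of n] j by (simp add: dist_real_def of_nat_diff)
  have "(\<integral>f. f ?x \<partial>M) \<le> (\<integral>f. \<bar>f ?x\<bar> \<partial>M)"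
    using int by (intro integral_mono) auto
  moreover have "t - (\<integral>f. f ?x \<partial>M) \<le> (\<integral>f. \<bar>t - f ?x\<bar> \<partial>M)"
  proof -
    have "t - (\<integral>f. f ?x \<partial>M) = (\<integral>f. t - f ?x \<partial>M)"
      using int by (simp add: prob_space)
    also have "\<dots> \<le> (\<integral>f. \<bar>t - f ?x\<bar> \<partial>M)"
      using int by (intro integral_mono) auto
    finally show ?thesis .
  qed
  moreover have "t * ((real n - real j) / real n) = t - t * (real j / real n)"
    using j by (simp add: field_simps)
  ultimately show ?thesis
    using 1 2 by simp
qed

lemma SPF_imp_AE_phantom:
  assumes M: "randomized_mechanism n M" and spf: "SPF_in_expectation n M"
    and sp: "universally_truthful n M" and j: "j \<le> n" and n: "n \<ge> 1"
  shows "AE f in M. phantom n f j \<in> {0, 1}"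
    and "(\<integral>f. phantom n f j \<partial>M) = (real n - real j) / real n"
proof -
  interpret prob_space M
    using M by (simp add: randomized_mechanism_def)
  note unan = SPF_imp_AE_unanimous[OF n M spf sp]
  note sp = sp[unfolded universally_truthful_def]
  have int: "integrable M (\<lambda>f. phantom n f j)" for j
    unfolding phantom_def
    by (rule randomized_mechanism_integrable[OF M block_profile_in_profiles]) auto
  \<comment> \<open>For \<open>j = 0\<close> and \<open>j = n\<close> one block is empty and
    unanimity decides instead of fairness.\<close>
  consider "j = 0" | "j = n" "n \<ge> 1" | "1 \<le> j" "j < n"
    using j n by linarith
  then have "(AE f in M. phantom n f j \<in> {0, 1}) \<and>
      (\<integral>f. phantom n f j \<partial>M) = (real n - real j) / real n"
  proof cases
    case 1
    have AE: "AE f in M. phantom n f j = 1"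
      using unan by eventually_elim (simp add: 1 phantom_0)
    have "(\<integral>f. phantom n f j \<partial>M) = (\<integral>f. 1 \<partial>M)"
      by (rule integral_cong_AE) (use AE int in auto)
    with AE 1 n show ?thesis
      by (auto simp: prob_space)
  next
    case 2
    have AE: "AE f in M. phantom n f j = 0"
      using unan by eventually_elim (simp add: 2 phantom_n)
    have "(\<integral>f. phantom n f j \<partial>M) = (\<integral>f. 0 \<partial>M)"
      by (rule integral_cong_AE) (use AE int in auto)
    with AE 2 show ?thesis
      by auto
  next
    case 3
    let ?a = "\<lambda>f. phantom n f j"
    have E1: "(\<integral>f. ?a f \<partial>M) = (real n - real j) / real n"
      unfolding phantom_def using SPF_expectation_block[OF M spf 3, of 1] by simp
    have range: "AE f in M. 0 \<le> ?a f \<and> ?a f \<le> 1"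
    proof (rule AE_I2)
      fix f
      assume "f \<in> space M"
      then have "f \<in> mechanisms n"
        using M by (simp add: randomized_mechanism_def)
      then show "0 \<le> ?a f \<and> ?a f \<le> 1"
        unfolding phantom_def by (rule mechanismsD[OF _ block_profile_in_profiles]) auto
    qed
    have int_half: "integrable M (\<lambda>f. f (block_profile n {1..j} 0 (1/2)))"
      by (rule randomized_mechanism_integrable[OF M block_profile_in_profiles]) auto
    have half: "AE f in M. f (block_profile n {1..j} 0 (1/2)) = min (1/2) (?a f)"
      using sp unan range
    proof eventually_elim
      case (elim f)
      then show ?case
        using block_outcome_eq_clamp[of n f 0 "1/2" j] j by simp
    qed
    \<comment> \<open>Almost surely this is \<open>min (1/2) a - a / 2\<close> with a in [0,1]:
      nonnegative, and zero only for a = 0 or a = 1. Its mean vanishes because the block expectation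
      is linear in \<open>t\<close>.\<close>
    let ?h = "\<lambda>f. f (block_profile n {1..j} 0 (1/2)) - ?a f / 2"
    have "(\<integral>f. ?h f \<partial>M) = 0"
      using int int_half SPF_expectation_block[OF M spf 3, of "1/2"] E1 by simp
    moreover have "AE f in M. 0 \<le> ?h f"
      using half range by eventually_elim auto
    moreover have "integrable M ?h"
      using int int_half by auto
    ultimately have "AE f in M. ?h f = 0"
      using integral_nonneg_eq_0_iff_AE by blast
    with half have "AE f in M. ?a f \<in> {0, 1}"
      by eventually_elim (auto simp: min_def split: if_splits)
    with E1 show ?thesis by simp
  qed
  then show "AE f in M. phantom n f j \<in> {0, 1}"
    and "(\<integral>f. phantom n f j \<partial>M) = (real n - real j) / real n"
    by blast+
qed

section \<open>Properties of Random Rank\<close>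

lemma rank_mechanism_measurable:
  assumes "space M = mechanisms n"
  shows "rank_mechanism n \<in> measurable (uniform_count_measure {1..n}) M"
proof (rule measurableI)
  fix k
  assume "k \<in> space (uniform_count_measure {1..n})"
  then show "rank_mechanism n k \<in> space M"
    using rank_mechanism_in_mechanisms assms by (simp add: space_uniform_count_measure)
qed (auto simp: space_uniform_count_measure sets_uniform_count_measure)

text \<open>The expected distance is the average of |x_i - x_j| over all agents j, which is at most
  \<open>?r\<close> for j in \<open>S\<close> and at most \<open>?R\<close> otherwise.\<close>

lemma SPF_random_rank:
  assumes n: "n \<ge> 1" and M: "randomized_mechanism n M" and eq: "M = random_rank n M"
  shows "SPF_in_expectation n M"
  unfolding SPF_in_expectation_def
proof (intro ballI allI impI)
  fix x S i
  assume x: "x \<in> profiles n" and S: "S \<subseteq> agents n" "S \<noteq> {}" and i: "i \<in> S"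
  have meas: "(\<lambda>f. f x) \<in> borel_measurable M" and space: "space M = mechanisms n"
    using M x by (auto simp: randomized_mechanism_def)
  have finS: "finite S"
    using S finite_agents finite_subset by blast
  have close: "\<bar>x i - x j\<bar> \<le> spread x T" if "i \<in> T" "j \<in> T" "finite T" for j T
  proof -
    have "x i \<le> Max (x ` T)" "x j \<le> Max (x ` T)" "Min (x ` T) \<le> x i" "Min (x ` T) \<le> x j"
      using that by auto
    then show ?thesis
      unfolding spread_def by linarith
  qed
  let ?R = "spread x (agents n)" and ?r = "spread x S"
  have r0: "0 \<le> ?r"
    using close[of S i] i finS by simp
  have "(\<integral>f. dist (x i) (f x) \<partial>M) = (\<integral>f. dist (x i) (f x) \<partial>random_rank n M)"
    using eq by simp
  also have "\<dots> = (\<integral>k. dist (x i) (rank_mechanism n k x) \<partial>uniform_count_measure {1..n})"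
    unfolding random_rank_def
    by (rule integral_distr[OF rank_mechanism_measurable[OF space]]) (use meas in measurable)
  also have "\<dots> = (\<Sum>k\<in>{1..n}. dist (x i) (rank_mechanism n k x)) / real n"
    by (simp add: integral_uniform_count_measure)
  also have "\<dots> = (\<Sum>j\<in>agents n. \<bar>x i - x j\<bar>) / real n"
    using sum_rank_mechanism[OF x, of "\<lambda>z. \<bar>x i - z\<bar>"] by (simp only: dist_real_def)
  also have "\<dots> \<le> (?R * (real n - real (card S)) + real n * ?r) / real n"
  proof (intro divide_right_mono)
    have "(\<Sum>j\<in>agents n. \<bar>x i - x j\<bar>) = (\<Sum>j\<in>agents n - S. \<bar>x i - x j\<bar>) + (\<Sum>j\<in>S. \<bar>x i - x j\<bar>)"
      using S by (intro sum.subset_diff) auto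
    also have "\<dots> \<le> (\<Sum>j\<in>agents n - S. ?R) + (\<Sum>j\<in>S. ?r)"
      using close[of "agents n"] close[of S] i S finS by (intro add_mono sum_mono) auto
    also have "\<dots> = ?R * (real n - real (card S)) + real (card S) * ?r"
      using S finS card_mono[OF finite_agents S(1)]
      by (simp add: card_Diff_subset of_nat_diff)
    also have "\<dots> \<le> ?R * (real n - real (card S)) + real n * ?r"
      using r0 card_mono[OF finite_agents S(1)] by (intro add_left_mono mult_right_mono) auto
    finally show "(\<Sum>j\<in>agents n. \<bar>x i - x j\<bar>) \<le> ?R * (real n - real (card S)) + real n * ?r" .
  qed simp
  also have "\<dots> = ?R * ((real n - real (card S)) / real n) + ?r"
    using n by (simp add: field_simps)
  finally show "(\<integral>f. dist (x i) (f x) \<partial>M) \<le> ?R * ((real n - real (card S)) / real n) + ?r" .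
qed

lemma AE_random_rank:
  assumes M: "randomized_mechanism n M" and eq: "M = random_rank n M"
    and P: "{f \<in> space M. P f} \<in> sets M" "\<And>k. k \<in> {1..n} \<Longrightarrow> P (rank_mechanism n k)"
  shows "AE f in M. P f"
proof -
  have space: "space M = mechanisms n"
    using M by (simp add: randomized_mechanism_def)
  have "AE k in uniform_count_measure {1..n}. P (rank_mechanism n k)"
    using P(2) by (intro AE_I2) (simp add: space_uniform_count_measure)
  then have "AE f in random_rank n M. P f"
    unfolding random_rank_def
    by (subst AE_distr_iff[OF rank_mechanism_measurable[OF space] P(1)])
  then show ?thesis
    by (subst eq)
qed

section \<open>Identification of the law\<close>

text \<open>The phantoms drop from 1 to 0 at a single index m, where \<open>f\<close> is
  \<open>rank^m\<close>, so only that summand survives. The identity expresses an indicator by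
  phantoms, whose means are known.\<close>

lemma sum_phantom_differences:
  assumes f: "f \<in> mechanisms n"
    and an: "anonymous n f" and sp: "strategyproof n f" and unan: "unanimous n f"
    and ph: "\<And>j. j \<le> n \<Longrightarrow> phantom n f j \<in> {0, 1}"
  shows "(\<Sum>k\<in>{1..n}. (phantom n f (k - 1) - phantom n f k) * indicator A (rank_mechanism n k))
    = (indicator A f :: real)"
proof -
  define m where "m = (LEAST j. phantom n f j = 0)"
  have m0: "phantom n f m = 0" and m_le: "m \<le> n"
    unfolding m_def using phantom_n[OF unan] by (rule LeastI, intro Least_le)
  have lt: "phantom n f j = 1" if "j < m" for j
    using ph[of j] not_less_Least[of j "\<lambda>j. phantom n f j = 0"] that m_le by (auto simp: m_def)
  have ge: "phantom n f j = 0" if "m \<le> j" "j \<le> n" for j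
    using phantom_antimono[OF sp f that] m0 ph[OF that(2)] by auto
  have "m \<noteq> 0"
    using phantom_0[OF unan] m0 by (metis zero_neq_one)
  then have m: "m \<in> {1..n}"
    using m_le by simp
  have f_eq: "f = rank_mechanism n m"
    using m m0 lt[of "m - 1"] by (intro eq_rank_mechanism[OF f an sp unan]) auto
  have diff: "phantom n f (k - 1) - phantom n f k = (if k = m then 1 else 0)" if "k \<in> {1..n}" for k
    using that m lt[of k] lt[of "k - 1"] ge[of k] ge[of "k - 1"] by (cases k m rule: linorder_cases) auto
  have "(\<Sum>k\<in>{1..n}. (phantom n f (k - 1) - phantom n f k) * indicator A (rank_mechanism n k))
      = (\<Sum>k\<in>{1..n}. if k = m then indicator A f else 0 :: real)"
    using f_eq diff by (intro sum.cong refl) auto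
  also have "\<dots> = indicator A f"
    using m by simp
  finally show ?thesis .
qed

text \<open>Integrating the preceding identity gives every event \<open>A\<close> the mass 1/n for
  each k with \<open>rank^k\<close> in \<open>A\<close>.\<close>

lemma eq_random_rank:
  assumes n: "n \<ge> 1" and M: "randomized_mechanism n M"
    and an: "universally_anonymous n M" and sp: "universally_truthful n M"
    and spf: "SPF_in_expectation n M"
  shows "M = random_rank n M"
proof (rule measure_eqI)
  show "sets M = sets (random_rank n M)"
    by (simp add: random_rank_def)
next
  fix A
  assume A: "A \<in> sets M"
  interpret prob_space M
    using M by (simp add: randomized_mechanism_def)
  have space: "space M = mechanisms n"
    using M by (simp add: randomized_mechanism_def)
  note rank_meas = rank_mechanism_measurable[OF space]
  interpret U: prob_space "uniform_count_measure {1..n}"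
    using n by (intro prob_space_uniform_count_measure) auto
  interpret RR: prob_space "random_rank n M"
    unfolding random_rank_def by (rule U.prob_space_distr[OF rank_meas])
  have int: "integrable M (\<lambda>f. phantom n f j)" for j
    unfolding phantom_def
    by (rule randomized_mechanism_integrable[OF M block_profile_in_profiles]) auto
  have "AE f in M. \<forall>j\<in>{..n}. phantom n f j \<in> {0, 1}"
    by (rule AE_finite_allI) (use SPF_imp_AE_phantom(1)[OF M spf sp _ n] in auto)
  with an[unfolded universally_anonymous_def] sp[unfolded universally_truthful_def]
    SPF_imp_AE_unanimous[OF n M spf sp]
  have AE: "AE f in M. indicator A f =
      (\<Sum>k\<in>{1..n}. (phantom n f (k - 1) - phantom n f k) * indicator A (rank_mechanism n k) :: real)"
    using AE_space
  proof eventually_elim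
    case (elim f)
    then show ?case
      using sum_phantom_differences[of f n A] space by auto
  qed
  have "measure M A = (\<integral>f. indicator A f \<partial>M)"
    using A by simp
  also have "\<dots> = (\<integral>f. (\<Sum>k\<in>{1..n}. (phantom n f (k - 1) - phantom n f k)
      * indicator A (rank_mechanism n k)) \<partial>M)"
    by (rule integral_cong_AE[OF _ _ AE]) (use A int in auto)
  also have "\<dots> = (\<Sum>k\<in>{1..n}. ((\<integral>f. phantom n f (k - 1) \<partial>M) - (\<integral>f. phantom n f k \<partial>M))
      * indicator A (rank_mechanism n k))"
    using int by simp
  also have "\<dots> = (\<Sum>k\<in>{1..n}. indicator A (rank_mechanism n k) / real n)"
  proof (rule sum.cong[OF refl])
    fix k
    assume k: "k \<in> {1..n}"
    \<comment> \<open>The means are (n - k + 1)/n and (n - k)/n; at k = 1 and k = n the values at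
      the ends 0 and n enter.\<close>
    have "(\<integral>f. phantom n f (k - 1) \<partial>M) - (\<integral>f. phantom n f k \<partial>M) = 1 / real n"
      using k SPF_imp_AE_phantom(2)[OF M spf sp _ n, of k]
        SPF_imp_AE_phantom(2)[OF M spf sp _ n, of "k - 1"]
      by (auto simp: of_nat_diff diff_divide_distrib[symmetric])
    then show "((\<integral>f. phantom n f (k - 1) \<partial>M) - (\<integral>f. phantom n f k \<partial>M))
        * indicator A (rank_mechanism n k) = indicator A (rank_mechanism n k) / real n"
      by simp
  qed
  also have "\<dots> = (\<integral>k. indicator A (rank_mechanism n k) \<partial>uniform_count_measure {1..n})"
    by (simp add: integral_uniform_count_measure sum_divide_distrib)
  also have "\<dots> = (\<integral>f. indicator A f \<partial>random_rank n M)"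
    unfolding random_rank_def
    by (rule integral_distr[OF rank_meas, symmetric]) (use A in simp)
  also have "\<dots> = measure (random_rank n M) A"
    using A sets.sets_into_space[OF A] by (simp add: random_rank_def Int_absorb2)
  finally show "emeasure M A = emeasure (random_rank n M) A"
    by (simp add: emeasure_eq_measure RR.emeasure_eq_measure)
qed

theorem theorem6:
  fixes n :: nat and M :: "((nat \<Rightarrow> real) \<Rightarrow> real) measure"
  assumes "n \<ge> 2"
    and "randomized_mechanism n M"
  shows "universally_anonymous n M \<and> universally_truthful n M \<and> SPF_in_expectation n M
           \<longleftrightarrow> M = random_rank n M"
proof
  have n: "n \<ge> 1"
    using assms(1) by simp
  show "M = random_rank n M"
    if "universally_anonymous n M \<and> universally_truthful n M \<and> SPF_in_expectation n M"
    using that eq_random_rank[OF n assms(2)] by blast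
  assume eq: "M = random_rank n M"
  \<comment> \<open>The measurability of both events, needed for \<open>AE_random_rank\<close>, is
    part of \<open>randomized_mechanism\<close>.\<close>
  have "universally_anonymous n M" "universally_truthful n M"
    unfolding universally_anonymous_def universally_truthful_def
    using assms(2) by (auto intro!: AE_random_rank[OF assms(2) eq]
      simp: randomized_mechanism_def anonymous_rank_mechanism strategyproof_rank_mechanism)
  with SPF_random_rank[OF n assms(2) eq]
  show "universally_anonymous n M \<and> universally_truthful n M \<and> SPF_in_expectation n M"
    by blast
qed

end
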